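(* Let $X$ be an infinite Hausdorff space. Then $\mathcal{O}_{cs}(X)\subseteq\mathcal{O}_{cs}(Y)$ for every closed subset $Y\subseteq X$ with $\mathcal{O}_{cs}(X)\subseteq Y$, where $Y$ carries the subspace topology.
   Context: For a Hausdorff space $X$, $\mathcal{F}(X)$ denotes the set of all nonempty closed subsets of $X$, endowed with the Vietoris topology, which is generated by all sets of the form $\langle\mathcal{V}\rangle=\{S\in\mathcal{F}(X): S\subseteq\bigcup\mathcal{V}\text{ and } S\cap V\neq\emptyset\text{ for all }V\in\mathcal{V}\}$, where $\mathcal{V}$ runs over the finite families of open subsets of $X$. A selection for $\mathcal{F}(X)$ is a map $f:\mathcal{F}(X)\to X$ with $f(S)\in S$ for every $S\in\mathcal{F}(X)$; it is continuous if it is continuous with respect to the Vietoris topology. Set $\mathcal{O}_{cs}(X)=\{f(X): f \text{ is a continuous selection for } \mathcal{F}(X)\}\subseteq X$ (this is empty if there are no continuous selections). The same definition is applied to subspaces $Y$ of $X$ (finite ones included), with $\mathcal{O}_{cs}(\emptyset)=\emptyset$. *)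

theory Defs
  imports "HOL-Analysis.Abstract_Topology"  "HOL-Analysis.T1_Spaces"
begin

definition nonempty_closed_sets :: "'a topology \<Rightarrow> 'a set set" where
  "nonempty_closed_sets X = {S. closedin X S \<and> S \<noteq> {}}"

definition vietoris_basic :: "'a topology \<Rightarrow> 'a set set \<Rightarrow> 'a set set" where
  "vietoris_basic X \<V> =
     {S \<in> nonempty_closed_sets X. S \<subseteq> \<Union>\<V> \<and> (\<forall>V\<in>\<V>. S \<inter> V \<noteq> {})}"

definition vietoris_topology :: "'a topology \<Rightarrow> 'a set topology" where
  "vietoris_topology X =
     topology_generated_by {vietoris_basic X \<V> |\<V>. finite \<V> \<and> (\<forall>V\<in>\<V>. openin X V)}"

lemma topspace_vietoris_topology [simp]:
  "topspace (vietoris_topology X) = nonempty_closed_sets X"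
proof -
  have "nonempty_closed_sets X = vietoris_basic X {topspace X}" if "topspace X \<noteq> {}"
    by (auto simp: vietoris_basic_def nonempty_closed_sets_def dest: closedin_subset)
  moreover have "nonempty_closed_sets X = {}" if "topspace X = {}"
    using that by (auto simp: nonempty_closed_sets_def dest: closedin_subset)
  moreover have "vietoris_basic X \<V> \<subseteq> nonempty_closed_sets X" for \<V>
    by (auto simp: vietoris_basic_def)
  moreover have "finite {topspace X} \<and> (\<forall>V\<in>{topspace X}. openin X V)"
    by simp
  ultimately show ?thesis
    unfolding vietoris_topology_def topology_generated_by_topspace by blast
qed

(* Only the values of f on nonempty_closed_sets X matter. *)
definition continuous_selection :: "'a topology \<Rightarrow> ('a set \<Rightarrow> 'a) \<Rightarrow> bool" where
  "continuous_selection X f \<longleftrightarrow>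
     (\<forall>S \<in> nonempty_closed_sets X. f S \<in> S) \<and> continuous_map (vietoris_topology X) X f"

(* For the empty space every f is vacuously a continuous selection and f {} is arbitrary;
   the side condition makes the set empty in that case. *)
definition O_cs :: "'a topology \<Rightarrow> 'a set" where
  "O_cs X = {f (topspace X) |f. topspace X \<noteq> {} \<and> continuous_selection X f}"

end

theory Submission
  imports Defs "HOL-Analysis.Abstract_Topological_Spaces"
begin

text \<open>Fix a continuous selection \<open>f\<close>. If a nonempty clopen set \<open>C\<close> were disjoint from \<open>Y\<close>, then
  selecting from \<open>S \<inter> C\<close> whenever possible would produce a point of \<open>O_cs X\<close> in \<open>C\<close>; hence
  no nonempty clopen set misses \<open>Y\<close>. This rigidity forces \<open>f (Y \<union> {z}) \<in> {f Y, z}\<close> for every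
  \<open>z\<close>, and likewise for every closed set containing \<open>Y\<close>. Adding finitely many points one at a
  time, in any order, one sees that \<open>f (Y \<union> Z)\<close> lies in the closed set \<open>{z. f (Y \<union> {z}) = z}\<close>
  for every finite \<open>Z\<close>. These sets \<open>Y \<union> Z\<close> approximate the whole space, so \<open>p = f X\<close> satisfies
  \<open>f (Y \<union> {p}) = p\<close>. As \<open>p \<in> Y\<close>, this says \<open>f Y = p\<close>, and \<open>f\<close> restricted to the closed subsets of
  \<open>Y\<close> is the required selection.\<close>

section \<open>The Vietoris topology\<close>

lemma openin_vietoris_basic:
  assumes "finite \<V>" "\<And>V. V \<in> \<V> \<Longrightarrow> openin X V"
  shows "openin (vietoris_topology X) (vietoris_basic X \<V>)"
  unfolding vietoris_topology_def
  by (rule topology_generated_by_Basis) (use assms in blast)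

lemma openin_vietoris_subset:
  assumes "openin X W"
  shows "openin (vietoris_topology X) {S \<in> nonempty_closed_sets X. S \<subseteq> W}"
proof -
  have "{S \<in> nonempty_closed_sets X. S \<subseteq> W} = vietoris_basic X {W}"
    by (auto simp: vietoris_basic_def nonempty_closed_sets_def)
  then show ?thesis
    using openin_vietoris_basic[of "{W}" X] assms by simp
qed

lemma openin_vietoris_meets:
  assumes "openin X V"
  shows "openin (vietoris_topology X) {S \<in> nonempty_closed_sets X. S \<inter> V \<noteq> {}}"
proof -
  \<comment> \<open>\<open>topspace X\<close> joins the family only to make the covering condition
    automatic.\<close>
  have "{S \<in> nonempty_closed_sets X. S \<inter> V \<noteq> {}} = vietoris_basic X {topspace X, V}"
    using openin_subset[OF assms]
    by (auto simp: vietoris_basic_def nonempty_closed_sets_def dest: closedin_subset)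
  then show ?thesis
    using openin_vietoris_basic[of "{topspace X, V}" X] assms by force
qed

lemma continuous_map_into_vietoris:
  assumes "h \<in> topspace Z \<rightarrow> nonempty_closed_sets X"
    and "\<And>\<V>. finite \<V> \<Longrightarrow> (\<And>V. V \<in> \<V> \<Longrightarrow> openin X V) \<Longrightarrow>
           openin Z {x \<in> topspace Z. h x \<in> vietoris_basic X \<V>}"
  shows "continuous_map Z (vietoris_topology X) h"
  unfolding vietoris_topology_def
proof (rule continuous_on_generated_topo)
  show "openin Z (h -` U \<inter> topspace Z)"
    if "U \<in> {vietoris_basic X \<V> |\<V>. finite \<V> \<and> (\<forall>V\<in>\<V>. openin X V)}" for U
  proof -
    from that obtain \<V> where \<V>: "U = vietoris_basic X \<V>" "finite \<V>" "\<forall>V\<in>\<V>. openin X V"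
      by blast
    have "h -` U \<inter> topspace Z = {x \<in> topspace Z. h x \<in> vietoris_basic X \<V>}"
      using \<V>(1) by auto
    then show ?thesis
      using assms(2) \<V> by auto
  qed
  show "h ` topspace Z \<subseteq> \<Union>{vietoris_basic X \<V> |\<V>. finite \<V> \<and> (\<forall>V\<in>\<V>. openin X V)}"
    using assms(1) topspace_vietoris_topology[of X]
    unfolding vietoris_topology_def topology_generated_by_topspace by auto
qed

text \<open>For a basic set, \<open>E\<close> consists of one point of \<open>S\<close> from each
  member of the finite family, and the covering condition passes to subsets of \<open>S\<close>;
  intersections are handled by uniting the two finite sets. Near \<open>S\<close>, one may therefore
  thin \<open>S\<close> out to any closed subset that keeps finitely many prescribed points.\<close>

lemma openin_vietoris_finite_core:
  assumes "openin (vietoris_topology X) \<U>" "S \<in> \<U>"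
  obtains E where "finite E" "E \<subseteq> S"
    "\<And>S'. closedin X S' \<Longrightarrow> S' \<noteq> {} \<Longrightarrow> E \<subseteq> S' \<Longrightarrow> S' \<subseteq> S \<Longrightarrow> S' \<in> \<U>"
proof -
  have "generate_topology_on
          {vietoris_basic X \<V> |\<V>. finite \<V> \<and> (\<forall>V\<in>\<V>. openin X V)} \<U>"
    using assms(1) by (simp add: vietoris_topology_def openin_topology_generated_by_iff)
  then have "\<forall>S\<in>\<U>. \<exists>E. finite E \<and> E \<subseteq> S \<and>
      (\<forall>S'. closedin X S' \<and> S' \<noteq> {} \<and> E \<subseteq> S' \<and> S' \<subseteq> S \<longrightarrow> S' \<in> \<U>)"
  proof induction
    case Empty
    then show ?case by simp
  next
    case (Int \<A> \<B>)
    show ?case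
    proof
      fix S assume "S \<in> \<A> \<inter> \<B>"
      with Int.IH obtain E1 E2 where
        "finite E1" "E1 \<subseteq> S"
        "\<forall>S'. closedin X S' \<and> S' \<noteq> {} \<and> E1 \<subseteq> S' \<and> S' \<subseteq> S \<longrightarrow> S' \<in> \<A>"
        "finite E2" "E2 \<subseteq> S"
        "\<forall>S'. closedin X S' \<and> S' \<noteq> {} \<and> E2 \<subseteq> S' \<and> S' \<subseteq> S \<longrightarrow> S' \<in> \<B>"
        by (metis IntD1 IntD2)
      then show "\<exists>E. finite E \<and> E \<subseteq> S \<and>
          (\<forall>S'. closedin X S' \<and> S' \<noteq> {} \<and> E \<subseteq> S' \<and> S' \<subseteq> S \<longrightarrow> S' \<in> \<A> \<inter> \<B>)"
        by (intro exI[of _ "E1 \<union> E2"]) auto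
    qed
  next
    case (UN K)
    then show ?case by (meson UnionE UnionI)
  next
    case (Basis \<B>)
    then obtain \<V> where \<V>: "\<B> = vietoris_basic X \<V>" "finite \<V>" by blast
    show ?case
    proof
      fix S assume S: "S \<in> \<B>"
      then have "\<forall>V\<in>\<V>. \<exists>x. x \<in> S \<inter> V" and S_sub: "S \<subseteq> \<Union>\<V>"
        by (auto simp: \<V> vietoris_basic_def)
      then obtain e where e: "\<And>V. V \<in> \<V> \<Longrightarrow> e V \<in> S \<inter> V" by metis
      have "S' \<in> \<B>" if S': "closedin X S'" "S' \<noteq> {}" "e ` \<V> \<subseteq> S'" "S' \<subseteq> S" for S'
      proof -
        have "S' \<inter> V \<noteq> {}" if "V \<in> \<V>" for V
          using e[OF that] S'(3) that by blast
        then show ?thesis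
          using S' S_sub by (simp add: \<V> vietoris_basic_def nonempty_closed_sets_def)
      qed
      moreover have "e ` \<V> \<subseteq> S" using e by blast
      ultimately show "\<exists>E. finite E \<and> E \<subseteq> S \<and>
          (\<forall>S'. closedin X S' \<and> S' \<noteq> {} \<and> E \<subseteq> S' \<and> S' \<subseteq> S \<longrightarrow> S' \<in> \<B>)"
        using \<V>(2) by (intro exI[of _ "e ` \<V>"]) simp
    qed
  qed
  with assms(2) that show thesis by meson
qed

text \<open>If \<V> covers \<open>T\<close>, membership in the basic set only asks that
  \<open>z\<close> lie in \<open>\<Union>\<V>\<close> and in each of the finitely many members of
  \<V> that miss \<open>T\<close>; this is an open condition on \<open>z\<close>.\<close>

lemma continuous_map_vietoris_Un_singleton:
  assumes "t1_space X" "closedin X T"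
  shows "continuous_map X (vietoris_topology X) (\<lambda>z. T \<union> {z})"
proof (rule continuous_map_into_vietoris)
  show "(\<lambda>z. T \<union> {z}) \<in> topspace X \<rightarrow> nonempty_closed_sets X"
    using assms unfolding nonempty_closed_sets_def
    by (auto simp: t1_space_closedin_singleton simp flip: Un_insert_right intro!: closedin_Un)
  fix \<V> assume \<V>: "finite \<V>" "\<And>V. V \<in> \<V> \<Longrightarrow> openin X V"
  have closed: "closedin X (T \<union> {z})" if "z \<in> topspace X" for z
    using that assms by (metis closedin_Un t1_space_closedin_singleton)
  show "openin X {z \<in> topspace X. T \<union> {z} \<in> vietoris_basic X \<V>}"
  proof (cases "T \<subseteq> \<Union>\<V>")
    case True
    have "{z \<in> topspace X. T \<union> {z} \<in> vietoris_basic X \<V>}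
        = (topspace X \<inter> \<Inter>{V \<in> \<V>. T \<inter> V = {}}) \<inter> \<Union>\<V>"
      using True closed unfolding vietoris_basic_def nonempty_closed_sets_def by auto
    moreover have "openin X (topspace X \<inter> \<Inter>{V \<in> \<V>. T \<inter> V = {}})"
      by (rule openin_Int_Inter) (use \<V> in auto)
    moreover have "openin X (\<Union>\<V>)"
      using \<V> by blast
    ultimately show ?thesis
      by (simp only: openin_Int)
  next
    case False
    then have "{z \<in> topspace X. T \<union> {z} \<in> vietoris_basic X \<V>} = {}"
      unfolding vietoris_basic_def by blast
    then show ?thesis by (simp only: openin_empty)
  qed
qed

text \<open>As \<open>C\<close> is clopen, the closed sets meeting \<open>C\<close> and those
  missing it form two complementary open parts of the hyperspace, so the two branches can be treated
  separately.\<close>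

lemma continuous_map_vietoris_Int_clopen:
  assumes "openin X C" "closedin X C"
  shows "continuous_map (vietoris_topology X) (vietoris_topology X)
           (\<lambda>S. if S \<inter> C \<noteq> {} then S \<inter> C else S)" (is "continuous_map _ _ ?h")
proof (rule continuous_map_into_vietoris)
  show "?h \<in> topspace (vietoris_topology X) \<rightarrow> nonempty_closed_sets X"
    using assms by (simp add: nonempty_closed_sets_def closedin_Int)
  fix \<V> assume \<V>: "finite \<V>" "\<And>V. V \<in> \<V> \<Longrightarrow> openin X V"
  let ?F = "nonempty_closed_sets X" and ?D = "topspace X - C"
  have D: "openin X ?D" using assms by blast
  have "openin X (\<Union>\<V> \<union> ?D)" using \<V> D by blast
  \<comment> \<open>For \<open>S\<close> meeting \<open>C\<close>, the conditions on
    \<open>S \<inter> C\<close> become open conditions on \<open>S\<close>: it is covered by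
    \<open>\<Union>\<V> \<union> ?D\<close> and meets each \<open>V \<inter> C\<close>. On
    \<open>?B\<close> the map is the identity.\<close>
  let ?A = "{S \<in> ?F. S \<inter> C \<noteq> {}} \<inter> {S \<in> ?F. S \<subseteq> \<Union>\<V> \<union> ?D}
              \<inter> (topspace (vietoris_topology X) \<inter> \<Inter>((\<lambda>V. {S \<in> ?F. S \<inter> (V \<inter> C) \<noteq> {}}) ` \<V>))"
  let ?B = "{S \<in> ?F. S \<subseteq> ?D} \<inter> vietoris_basic X \<V>"
  have meets: "openin (vietoris_topology X)
      (topspace (vietoris_topology X) \<inter> \<Inter>((\<lambda>V. {S \<in> ?F. S \<inter> (V \<inter> C) \<noteq> {}}) ` \<V>))"
  proof (rule openin_Int_Inter)
    show "openin (vietoris_topology X) U"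
      if "U \<in> (\<lambda>V. {S \<in> ?F. S \<inter> (V \<inter> C) \<noteq> {}}) ` \<V>" for U
    proof -
      from that obtain V where V: "V \<in> \<V>" "U = {S \<in> ?F. S \<inter> (V \<inter> C) \<noteq> {}}" by blast
      show ?thesis
        unfolding V(2) by (intro openin_vietoris_meets openin_Int \<V>(2) V(1) assms(1))
    qed
  qed (simp_all add: \<V>(1) flip: topspace_vietoris_topology)
  have "openin (vietoris_topology X) (?A \<union> ?B)"
    by (intro openin_Un openin_Int[OF openin_Int] openin_Int[OF openin_vietoris_subset]
        meets openin_vietoris_meets openin_vietoris_subset openin_vietoris_basic assms(1) D \<V>
        \<open>openin X (\<Union>\<V> \<union> ?D)\<close>)
  moreover have "{S \<in> topspace (vietoris_topology X). ?h S \<in> vietoris_basic X \<V>} = ?A \<union> ?B"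
  proof (intro set_eqI)
    fix S
    have S: "S \<subseteq> topspace X" "closedin X (S \<inter> C)" if "S \<in> ?F"
      using that assms by (auto simp: nonempty_closed_sets_def dest: closedin_subset)
    show "S \<in> {S \<in> topspace (vietoris_topology X). ?h S \<in> vietoris_basic X \<V>} \<longleftrightarrow> S \<in> ?A \<union> ?B"
    proof (cases "S \<in> ?F")
      case True
      show ?thesis
      proof (cases "S \<inter> C = {}")
        case False
        with True S[OF True] show ?thesis
          unfolding vietoris_basic_def nonempty_closed_sets_def by (auto simp: Int_ac)
      qed (use True S[OF True] in \<open>auto\<close>)
    qed simp
  qed
  ultimately show "openin (vietoris_topology X)
      {S \<in> topspace (vietoris_topology X). ?h S \<in> vietoris_basic X \<V>}"
    by simp
qed

text \<open>Closed subsets of the closed set \<open>Y\<close> are closed in \<open>X\<close>, and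
  the trace of a basic set is the basic set of the traces \<open>V \<inter> Y\<close>.\<close>

lemma continuous_map_vietoris_closed_subspace:
  assumes "closedin X Y"
  shows "continuous_map (vietoris_topology (subtopology X Y)) (vietoris_topology X) (\<lambda>S. S)"
proof (rule continuous_map_into_vietoris)
  show "(\<lambda>S. S) \<in> topspace (vietoris_topology (subtopology X Y)) \<rightarrow> nonempty_closed_sets X"
    using assms by (auto simp: nonempty_closed_sets_def closedin_closed_subtopology)
  fix \<V> assume \<V>: "finite \<V>" "\<And>V. V \<in> \<V> \<Longrightarrow> openin X V"
  have "{S \<in> topspace (vietoris_topology (subtopology X Y)). S \<in> vietoris_basic X \<V>}
      = vietoris_basic (subtopology X Y) ((\<lambda>V. V \<inter> Y) ` \<V>)"
    using assms by (auto simp: vietoris_basic_def nonempty_closed_sets_def closedin_closed_subtopology)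
      blast+
  then show "openin (vietoris_topology (subtopology X Y))
      {S \<in> topspace (vietoris_topology (subtopology X Y)). S \<in> vietoris_basic X \<V>}"
    using \<V> by (auto intro!: openin_vietoris_basic simp: openin_subtopology_Int)
qed

section \<open>Continuous selections\<close>

lemma continuous_selection_in:
  "continuous_selection X f \<Longrightarrow> closedin X S \<Longrightarrow> S \<noteq> {} \<Longrightarrow> f S \<in> S"
  by (auto simp: continuous_selection_def nonempty_closed_sets_def)

lemma continuous_selection_finite_core:
  assumes "continuous_selection X f" "closedin X S" "S \<noteq> {}" "openin X U" "f S \<in> U"
  shows "\<exists>E. finite E \<and> E \<subseteq> S \<and>
    (\<forall>S'. closedin X S' \<longrightarrow> S' \<noteq> {} \<longrightarrow> E \<subseteq> S' \<longrightarrow> S' \<subseteq> S \<longrightarrow> f S' \<in> U)"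
proof -
  have "openin (vietoris_topology X) {S \<in> topspace (vietoris_topology X). f S \<in> U}"
    using assms(1,4) openin_continuous_map_preimage unfolding continuous_selection_def by blast
  moreover have "S \<in> {S \<in> topspace (vietoris_topology X). f S \<in> U}"
    using assms by (simp add: nonempty_closed_sets_def)
  ultimately show ?thesis
    by (rule openin_vietoris_finite_core) blast
qed

lemma continuous_map_selection_Un_singleton:
  assumes "t1_space X" "continuous_selection X f" "closedin X T"
  shows "continuous_map X X (\<lambda>z. f (T \<union> {z}))"
  using continuous_map_compose[OF continuous_map_vietoris_Un_singleton[OF assms(1,3)]] assms(2)
  by (auto simp: continuous_selection_def o_def)

lemma closedin_Un_finite:
  assumes "t1_space X" "closedin X T" "finite Z" "Z \<subseteq> topspace X"
  shows "closedin X (T \<union> Z)"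
  using assms by (metis closedin_Un t1_space_closedin_finite)

text \<open>Precomposing \<open>f\<close> with the map that cuts \<open>S\<close> down to
  \<open>S \<inter> C\<close> when possible gives another continuous selection; its value at the
  whole space is \<open>f C\<close>, a point of \<open>C\<close>.\<close>

lemma O_cs_meets_clopen:
  assumes f: "continuous_selection X f" and C: "openin X C" "closedin X C" "C \<noteq> {}"
  shows "O_cs X \<inter> C \<noteq> {}"
proof -
  let ?h = "\<lambda>S. if S \<inter> C \<noteq> {} then S \<inter> C else S"
  have "continuous_map (vietoris_topology X) X (f \<circ> ?h)"
    using continuous_map_compose[OF continuous_map_vietoris_Int_clopen[OF C(1,2)]] f
    unfolding continuous_selection_def by blast
  moreover have "(f \<circ> ?h) S \<in> S" if "S \<in> nonempty_closed_sets X" for S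
    using that C continuous_selection_in[OF f, of "S \<inter> C"] continuous_selection_in[OF f, of S]
    by (auto simp: nonempty_closed_sets_def)
  ultimately have "continuous_selection X (f \<circ> ?h)"
    unfolding continuous_selection_def by blast
  moreover have "topspace X \<inter> C = C"
    using closedin_subset[OF C(2)] by blast
  moreover have "topspace X \<noteq> {}"
    using C closedin_subset by blast
  ultimately have "f C \<in> O_cs X"
    unfolding O_cs_def using C(3) by (intro CollectI exI[of _ "f \<circ> ?h"]) simp
  with continuous_selection_in[OF f C(2,3)] show ?thesis by blast
qed

section \<open>Adjoining one point to a closed set\<close>

text \<open>A jump to a third value lands in \<open>Y\<close>. Thinning \<open>Y\<close> to a set
  \<open>T\<close> with only finitely many points in \<open>N\<close> preserves the jump and makes
  the new value \<open>e\<close> isolated in \<open>T\<close>. The fibre of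
  \<open>w \<mapsto> f (T \<union> {w})\<close> over \<open>e\<close> is then clopen, and it misses
  \<open>T\<close>, hence meets \<open>Y\<close> only inside \<open>N\<close>.\<close>

lemma selection_jump_clopen:
  assumes X: "Hausdorff_space X" and f: "continuous_selection X f"
    and Y: "closedin X Y" "Y \<noteq> {}"
    and z: "z \<in> topspace X" "f (Y \<union> {z}) \<noteq> f Y" "f (Y \<union> {z}) \<noteq> z"
    and N0: "openin X N0" "f (Y \<union> {z}) \<in> N0"
  obtains C where "openin X C" "closedin X C" "z \<in> C" "C \<inter> Y \<subseteq> N0"
proof -
  note t1 = Hausdorff_imp_t1_space[OF X]
  have Yz: "closedin X (Y \<union> {z})"
    using t1 Y z by (simp add: closedin_Un_finite del: Un_insert_right)
  have Yzne: "Y \<union> {z} \<noteq> {}" by blast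
  have rY: "f Y \<in> Y" and yY: "f (Y \<union> {z}) \<in> Y"
    using continuous_selection_in[OF f Y] continuous_selection_in[OF f Yz] z by auto
  have "f Y \<in> topspace X" "f (Y \<union> {z}) \<in> topspace X"
    using rY yY closedin_subset[OF Y(1)] by blast+
  then obtain M N1 where MN1: "openin X M" "openin X N1" "f Y \<in> M" "f (Y \<union> {z}) \<in> N1" "disjnt M N1"
    using X z(2)[symmetric] unfolding Hausdorff_space_def by meson
  \<comment> \<open>Excluding \<open>z\<close> ensures that a value in \<open>N\<close> selected
    from \<open>T \<union> {z}\<close> lies in \<open>T\<close>.\<close>
  define N where "N = N0 \<inter> N1 - {z}"
  have N: "openin X N" "f (Y \<union> {z}) \<in> N" "N \<subseteq> N0" "z \<notin> N" "M \<inter> N = {}"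
    using N0 MN1 z t1 by (auto simp: N_def disjnt_def t1_space_closedin_singleton)
  obtain E1 where E1: "finite E1" "E1 \<subseteq> Y"
    "\<forall>S. closedin X S \<longrightarrow> S \<noteq> {} \<longrightarrow> E1 \<subseteq> S \<longrightarrow> S \<subseteq> Y \<longrightarrow> f S \<in> M"
    using continuous_selection_finite_core[OF f Y MN1(1,3)] by (elim exE conjE)
  obtain E2 where E2: "finite E2" "E2 \<subseteq> Y \<union> {z}"
    "\<forall>S. closedin X S \<longrightarrow> S \<noteq> {} \<longrightarrow> E2 \<subseteq> S \<longrightarrow> S \<subseteq> Y \<union> {z} \<longrightarrow> f S \<in> N"
    using continuous_selection_finite_core[OF f Yz Yzne N(1,2)] by (elim exE conjE)
  \<comment> \<open>Dropping \<open>z\<close> keeps \<open>E\<close> inside \<open>Y\<close>; the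
    set \<open>T \<union> {z}\<close> still contains all of \<open>E2\<close>.\<close>
  define E where "E = E1 \<union> (E2 - {z})"
  have E: "finite E" "E \<subseteq> Y" using E1 E2 by (auto simp: E_def)
  have YN: "closedin X (Y - N)" using Y N by blast
  have EX: "E \<subseteq> topspace X" using E closedin_subset[OF Y(1)] by blast
  define T where "T = (Y - N) \<union> E"
  have T: "closedin X T" "T \<subseteq> Y" "T \<noteq> {}"
    using closedin_Un_finite[OF t1 YN E(1) EX] E rY MN1 N by (auto simp: T_def)
  have Tw: "closedin X (T \<union> {w})" if "w \<in> topspace X" for w
    using t1 T(1) that by (simp add: closedin_Un_finite del: Un_insert_right)
  define \<psi> where "\<psi> = (\<lambda>w. f (T \<union> {w}))"
  have \<psi>: "continuous_map X X \<psi>"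
    unfolding \<psi>_def by (rule continuous_map_selection_Un_singleton[OF t1 f T(1)])
  have \<psi>_in: "\<psi> w \<in> T \<union> {w}" if "w \<in> topspace X" for w
    unfolding \<psi>_def using continuous_selection_in[OF f Tw[OF that]] by blast
  have fT: "f T \<in> M" by (rule E1(3)[rule_format]) (use T in \<open>auto simp: T_def E_def\<close>)
  define e where "e = \<psi> z"
  have "f (T \<union> {z}) \<in> N"
    by (rule E2(3)[rule_format, OF Tw[OF z(1)]]) (use T in \<open>auto simp: T_def E_def\<close>)
  then have e: "e \<in> N" by (simp add: e_def \<psi>_def)
  then have eT: "e \<in> T" using \<psi>_in[OF z(1)] N by (auto simp: e_def)
  have \<psi>T: "\<psi> w = f T" if "w \<in> T" for w
    using that by (simp add: \<psi>_def insert_absorb)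
  have fTe: "f T \<noteq> e" using fT e N by blast
  define C where "C = {w \<in> topspace X. \<psi> w \<in> {e}}"
  have "closedin X C"
    unfolding C_def
    by (rule closedin_continuous_map_preimage[OF \<psi>])
      (use t1 eT closedin_subset[OF T(1)] in \<open>auto simp: t1_space_closedin_singleton\<close>)
  moreover have "openin X C"
  proof -
    \<comment> \<open>As \<open>e\<close> lies in \<open>N\<close>, deleting it affects only the
      finite part \<open>E\<close>, so \<open>e\<close> is isolated in \<open>T\<close>.\<close>
    have "T - {e} = (Y - N) \<union> (E - {e})" using e by (auto simp: T_def)
    then have "closedin X (T - {e})"
      using closedin_Un_finite[OF t1 YN, of "E - {e}"] E EX by auto
    then have "closedin X ({w \<in> topspace X. \<psi> w = w} \<union> {w \<in> topspace X. \<psi> w \<in> T - {e}})"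
      using closedin_continuous_maps_eq[OF X \<psi> continuous_map_id[unfolded id_def]]
        closedin_continuous_map_preimage[OF \<psi>] by (intro closedin_Un)
    \<comment> \<open>The value at \<open>w\<close> lies in \<open>T\<close> or is \<open>w\<close>
      itself. A fixed point in \<open>C\<close> would have to be \<open>e\<close>, but the value at
      \<open>e\<close> is \<open>f T\<close>, which differs from \<open>e\<close>.\<close>
    moreover have "topspace X - C = {w \<in> topspace X. \<psi> w = w} \<union> {w \<in> topspace X. \<psi> w \<in> T - {e}}"
      using \<psi>_in \<psi>T[OF eT] fTe by (auto simp: C_def)
    ultimately show ?thesis
      by (simp add: openin_closedin_eq C_def)
  qed
  moreover have "z \<in> C" using z by (simp add: C_def e_def)
  moreover have "C \<inter> Y \<subseteq> N0"
  proof
    fix w assume w: "w \<in> C \<inter> Y"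
    then have "w \<notin> T" using \<psi>T fTe by (auto simp: C_def)
    with w show "w \<in> N0" using N(3) by (auto simp: T_def)
  qed
  ultimately show thesis using that by metis
qed

text \<open>The set \<open>K\<close> of points violating the claim is open and disjoint from
  \<open>Y\<close>, so no nonempty part of it is clopen. Inside a clopen set around \<open>z\<close>
  it therefore has a limit point outside \<open>K\<close>, where the value is \<open>f Y\<close>.
  Nearby points of \<open>K\<close> yield a second clopen set whose trace on \<open>Y\<close> is
  disjoint from that of the first, although the two clopen sets intersect.\<close>

lemma selection_Un_singleton:
  assumes X: "Hausdorff_space X" and f: "continuous_selection X f"
    and Y: "closedin X Y" "Y \<noteq> {}"
    and meets: "\<And>C. openin X C \<Longrightarrow> closedin X C \<Longrightarrow> C \<noteq> {} \<Longrightarrow> C \<inter> Y \<noteq> {}"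
    and z: "z \<in> topspace X"
  shows "f (Y \<union> {z}) \<in> {f Y, z}"
proof (rule ccontr)
  assume "f (Y \<union> {z}) \<notin> {f Y, z}"
  note t1 = Hausdorff_imp_t1_space[OF X]
  define \<phi> where "\<phi> = (\<lambda>z. f (Y \<union> {z}))"
  have \<phi>: "continuous_map X X \<phi>"
    unfolding \<phi>_def by (rule continuous_map_selection_Un_singleton[OF t1 f Y(1)])
  have \<phi>_in: "\<phi> w \<in> Y \<union> {w}" if "w \<in> topspace X" for w
    unfolding \<phi>_def using t1 Y that
    by (intro continuous_selection_in[OF f]) (auto simp del: Un_insert_right intro!: closedin_Un_finite)
  have \<phi>Y: "\<phi> w = f Y" if "w \<in> Y" for w
    using that by (simp add: \<phi>_def insert_absorb)
  have rY: "f Y \<in> Y" by (rule continuous_selection_in[OF f Y])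
  define K where "K = {w \<in> topspace X. \<phi> w \<noteq> f Y \<and> \<phi> w \<noteq> w}"
  have zK: "z \<in> K" using \<open>f (Y \<union> {z}) \<notin> {f Y, z}\<close> z by (simp add: K_def \<phi>_def)
  have openK: "openin X K"
  proof -
    have "closedin X {w \<in> topspace X. \<phi> w \<in> {f Y}}"
      by (rule closedin_continuous_map_preimage[OF \<phi>])
        (use t1 rY closedin_subset[OF Y(1)] in \<open>auto simp: t1_space_closedin_singleton\<close>)
    then have "closedin X ({w \<in> topspace X. \<phi> w \<in> {f Y}} \<union> {w \<in> topspace X. \<phi> w = w})"
      using closedin_continuous_maps_eq[OF X \<phi> continuous_map_id[unfolded id_def]]
      by (intro closedin_Un)
    moreover have "topspace X - K = {w \<in> topspace X. \<phi> w \<in> {f Y}} \<union> {w \<in> topspace X. \<phi> w = w}"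
      by (auto simp: K_def)
    ultimately show ?thesis
      by (simp add: openin_closedin_eq K_def)
  qed
  have KY: "K \<inter> Y = {}" using \<phi>Y by (auto simp: K_def)
  have clopen: "\<exists>C. openin X C \<and> closedin X C \<and> w \<in> C \<and> C \<inter> Y \<subseteq> N"
    if "w \<in> K" "openin X N" "\<phi> w \<in> N" for w N
    using that selection_jump_clopen[OF X f Y, of w N] unfolding K_def \<phi>_def by blast
  have "\<phi> z \<in> topspace X" "f Y \<in> topspace X" "f Y \<noteq> \<phi> z"
    using \<phi>_in zK rY closedin_subset[OF Y(1)] by (auto simp: K_def)
  then obtain M N where MN: "openin X M" "openin X N" "f Y \<in> M" "\<phi> z \<in> N" "disjnt M N"
    using X unfolding Hausdorff_space_def by meson
  obtain C where C: "openin X C" "closedin X C" "z \<in> C" "C \<inter> Y \<subseteq> N"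
    using clopen[OF zK MN(2,4)] by blast
  \<comment> \<open>Otherwise \<open>C \<inter> K\<close> would be a nonempty clopen set missing
    \<open>Y\<close>.\<close>
  have "\<not> closedin X (C \<inter> K)"
    using meets[of "C \<inter> K"] C openK zK KY by blast
  then have "\<not> X closure_of (C \<inter> K) \<subseteq> C \<inter> K"
    using openin_subset[OF openK] closure_of_subset_eq[of "C \<inter> K" X] by blast
  then obtain w where w: "w \<in> X closure_of (C \<inter> K)" "w \<notin> C \<inter> K" by blast
  have "w \<in> C" using w(1) C(2) by (meson closure_of_minimal inf_le1 subsetD)
  have wX: "w \<in> topspace X" using w(1) in_closure_of by fast
  \<comment> \<open>On \<open>K\<close> the selected point is not the added one, so it belongs to
    the closed set \<open>Y\<close>; this persists at the limit point \<open>w\<close>. If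
    \<open>w\<close> is fixed by \<phi>, it then lies in \<open>Y\<close>, and the value is
    \<open>f Y\<close> in that case too.\<close>
  have "K \<subseteq> {w \<in> topspace X. \<phi> w \<in> Y}" using \<phi>_in by (force simp: K_def)
  then have "w \<in> {w \<in> topspace X. \<phi> w \<in> Y}"
    using w(1) closure_of_minimal[OF _ closedin_continuous_map_preimage[OF \<phi> Y(1)]] by blast
  then have "\<phi> w = f Y" using w(2) \<open>w \<in> C\<close> \<phi>Y by (auto simp: K_def)
  then have "w \<in> {w \<in> topspace X. \<phi> w \<in> M}" using MN wX by simp
  then have "\<exists>z'. z' \<in> C \<inter> K \<and> z' \<in> {w \<in> topspace X. \<phi> w \<in> M}"
    using w(1)[unfolded in_closure_of] openin_continuous_map_preimage[OF \<phi> MN(1)] by meson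
  then obtain z' where z': "z' \<in> C \<inter> K" "\<phi> z' \<in> M"
    by (metis (mono_tags, lifting) mem_Collect_eq)
  obtain C' where C': "openin X C'" "closedin X C'" "z' \<in> C'" "C' \<inter> Y \<subseteq> M"
    using clopen[of z' M] z' MN(1) by blast
  have "(C \<inter> C') \<inter> Y = {}" using C(4) C'(4) MN(5) by (auto simp: disjnt_def)
  then show False using meets[of "C \<inter> C'"] C C' z' by blast
qed

section \<open>Finitely many points and passage to the whole space\<close>

text \<open>The hypothesis \<open>meets\<close> is inherited by larger sets, so at each step the
  one-point result applies with the set built so far in place of \<open>Y\<close>.\<close>

lemma selection_Un_finite:
  assumes X: "Hausdorff_space X" and f: "continuous_selection X f"
    and Y: "closedin X Y" "Y \<noteq> {}"
    and meets: "\<And>C. openin X C \<Longrightarrow> closedin X C \<Longrightarrow> C \<noteq> {} \<Longrightarrow> C \<inter> Y \<noteq> {}"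
    and Z: "finite Z" "Z \<subseteq> topspace X"
  shows "f (Y \<union> Z) \<in> insert (f Y) Z"
  using Z
proof (induction Z)
  case (insert z Z)
  have "f ((Y \<union> Z) \<union> {z}) \<in> {f (Y \<union> Z), z}"
  proof (rule selection_Un_singleton[OF X f])
    show "closedin X (Y \<union> Z)"
      using insert closedin_Un_finite[OF Hausdorff_imp_t1_space[OF X] Y(1)] by simp
    show "C \<inter> (Y \<union> Z) \<noteq> {}" if "openin X C" "closedin X C" "C \<noteq> {}" for C
      using meets[OF that] by blast
  qed (use Y insert in auto)
  then show ?case using insert by auto
qed simp

text \<open>The value at the whole space is approximated by the values
  \<open>f (Y \<union> E)\<close> with \<open>E\<close> finite, all of which lie in the closed set
  \<open>G\<close>. For a point of \<open>Y\<close>, membership in \<open>G\<close> means being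
  \<open>f Y\<close>.\<close>

lemma selection_closed_eq_selection_space:
  assumes X: "Hausdorff_space X" and f: "continuous_selection X f"
    and Y: "closedin X Y" "f (topspace X) \<in> Y"
    and meets: "\<And>C. openin X C \<Longrightarrow> closedin X C \<Longrightarrow> C \<noteq> {} \<Longrightarrow> C \<inter> Y \<noteq> {}"
  shows "f Y = f (topspace X)"
proof -
  note t1 = Hausdorff_imp_t1_space[OF X]
  have Yne: "Y \<noteq> {}" using Y by blast
  have YX: "Y \<subseteq> topspace X" using closedin_subset[OF Y(1)] .
  define G where "G = {z \<in> topspace X. f (Y \<union> {z}) = z}"
  have G: "closedin X G"
    unfolding G_def
    by (rule closedin_continuous_maps_eq[OF X continuous_map_selection_Un_singleton[OF t1 f Y(1)]
          continuous_map_id[unfolded id_def]])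
  have fG: "f (Y \<union> Z) \<in> G" if Z: "finite Z" "Z \<subseteq> topspace X" for Z
  proof -
    define s where "s = f (Y \<union> Z)"
    have "s \<in> Y \<union> Z"
      unfolding s_def using Z Y Yne t1
      by (intro continuous_selection_in[OF f]) (auto intro!: closedin_Un_finite)
    then have sX: "s \<in> topspace X" using YX Z by blast
    have closed: "closedin X (Y \<union> {s})"
      using t1 Y sX by (simp add: closedin_Un_finite del: Un_insert_right)
    have "f (Y \<union> {s}) = s"
    proof (cases "s \<in> Z")
      case True
      \<comment> \<open>add \<open>s\<close> first: the remaining points cannot produce the value \<open>s\<close>\<close>
      have "f ((Y \<union> {s}) \<union> (Z - {s})) \<in> insert (f (Y \<union> {s})) (Z - {s})"
      proof (rule selection_Un_finite[OF X f closed])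
        show "C \<inter> (Y \<union> {s}) \<noteq> {}" if "openin X C" "closedin X C" "C \<noteq> {}" for C
          using meets[OF that] by blast
      qed (use Z in auto)
      moreover have "(Y \<union> {s}) \<union> (Z - {s}) = Y \<union> Z" using True by blast
      ultimately show ?thesis by (auto simp: s_def)
    next
      case False
      \<comment> \<open>A value outside \<open>Z\<close> can only be \<open>f Y\<close>, so
        adjoining \<open>s\<close> to \<open>Y\<close> changes nothing.\<close>
      then have "s = f Y"
        using selection_Un_finite[OF X f Y(1) Yne meets Z] by (simp add: s_def)
      then show ?thesis
        using continuous_selection_in[OF f Y(1) Yne] by (simp add: insert_absorb)
    qed
    then show ?thesis using sX by (simp add: G_def s_def)
  qed
  have "f (topspace X) \<in> G"
  proof (rule ccontr)
    assume "f (topspace X) \<notin> G"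
    moreover have "openin X (topspace X - G)" using G by blast
    ultimately obtain E where E: "finite E" "E \<subseteq> topspace X"
      "\<forall>S. closedin X S \<longrightarrow> S \<noteq> {} \<longrightarrow> E \<subseteq> S \<longrightarrow> S \<subseteq> topspace X \<longrightarrow> f S \<in> topspace X - G"
      using continuous_selection_finite_core[OF f, of "topspace X" "topspace X - G"] Y YX Yne
      by blast
    \<comment> \<open>\<open>Y \<union> E\<close> is closed and contains \<open>E\<close>, so it is
      close enough to the whole space for its value to avoid \<open>G\<close>.\<close>
    have "f (Y \<union> E) \<in> topspace X - G"
      by (rule E(3)[rule_format]) (use E YX Yne closedin_Un_finite[OF t1 Y(1)] in auto)
    with fG[OF E(1,2)] show False by blast
  qed
  then show ?thesis using Y(2) by (simp add: G_def insert_absorb)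
qed

section \<open>Restriction to the closed subspace\<close>

lemma continuous_selection_subtopology:
  assumes f: "continuous_selection X f" and Y: "closedin X Y"
  shows "continuous_selection (subtopology X Y) f"
proof -
  have in_S: "f S \<in> S" if "S \<in> nonempty_closed_sets (subtopology X Y)" for S
    using that Y continuous_selection_in[OF f]
    by (auto simp: nonempty_closed_sets_def closedin_closed_subtopology)
  have "continuous_map (vietoris_topology (subtopology X Y)) X f"
    using continuous_map_compose[OF continuous_map_vietoris_closed_subspace[OF Y]] f
    by (auto simp: continuous_selection_def o_def)
  moreover have "f S \<in> Y" if "S \<in> nonempty_closed_sets (subtopology X Y)" for S
    using in_S[OF that] that Y by (auto simp: nonempty_closed_sets_def closedin_closed_subtopology)
  ultimately show ?thesis
    using in_S by (auto simp: continuous_selection_def continuous_map_in_subtopology)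
qed

theorem theorem3p8:
  fixes X :: "'a topology" and Y :: "'a set"
  assumes "Hausdorff_space X" and "infinite (topspace X)"
    and "closedin X Y" and "O_cs X \<subseteq> Y"
  shows "O_cs X \<subseteq> O_cs (subtopology X Y)"
proof
  fix p assume p: "p \<in> O_cs X"
  then obtain f where f: "continuous_selection X f" "p = f (topspace X)"
    by (auto simp: O_cs_def)
  have pY: "p \<in> Y" using p assms(4) by blast
  \<comment> \<open>Every nonempty clopen set contains a point of \<open>O_cs X\<close>, hence of
    \<open>Y\<close>; this supplies the rigidity hypothesis.\<close>
  have "f Y = p"
    using selection_closed_eq_selection_space[OF assms(1) f(1) assms(3)] f pY
      O_cs_meets_clopen[OF f(1)] assms(4) by blast
  moreover have "topspace (subtopology X Y) = Y"
    using closedin_subset[OF assms(3)] by auto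
  \<comment> \<open>The point \<open>p\<close> also witnesses that \<open>Y\<close> is nonempty, as
    the definition of \<open>O_cs\<close> demands.\<close>
  ultimately show "p \<in> O_cs (subtopology X Y)"
    using continuous_selection_subtopology[OF f(1) assms(3)] pY by (auto simp: O_cs_def)
qed

end
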